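(* Let $G$ be a spinal Hanoi towers group acting on the $d$-ary tree, and let $I=\{1,\dots,d\}$. Then: (i) for every $g\in G$ and every $i\in I$, $\mathrm{syl}(g|_i)\leq\lceil \mathrm{syl}(g)/2\rceil$; (ii) for every $g\in G$, $\sum_{i\in I}\mathrm{syl}(g|_i)\leq\mathrm{syl}(g)$.
   Context: $\mathcal T_d$ is the $d$-regular rooted tree whose vertices are the finite words over $\{1,\dots,d\}$. Automorphisms and permutations act on the right and products are read from left to right. For $g\in\mathrm{Aut}(\mathcal T_d)$ and a vertex $v$, the section $g|_v$ is defined by $(vw)^g=v^g\,w^{g|_v}$; we write $\psi(g)=(g|_1,\dots,g|_d)\tau$, where $\tau$ is the action of $g$ on the first level. Given $\sigma_1,\dots,\sigma_d\in\mathrm{Sym}(d)$ with $\sigma_i\neq 1$ and $\sigma_i$ fixing $i$ for each $i$, let $a_i\in\mathrm{Aut}(\mathcal T_d)$ be defined recursively by $\psi(a_i)=(1,\dots,1,a_i,1,\dots,1)\sigma_i$, with $a_i$ in the $i$-th coordinate. Any group $G=\langle a_1,\dots,a_d\rangle$ of this form is a spinal Hanoi towers group. The order $o(a_i)$ of $a_i$ is finite and equals the order of $\sigma_i$. All sections of elements of $G$ lie in $G$. The syllable length $\mathrm{syl}(g)$ of $g\in G$ is the minimal $k\ge0$ such that $g=a_{i_1}^{r_1}\cdots a_{i_k}^{r_k}$ for some indices with $i_j\ne i_{j+1}$ ($1\le j<k$) and exponents $1\le r_j<o(a_{i_j})$; equivalently, the word length of $g$ with respect to the generating set $\{a_i^r\mid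 1\le i\le d,\ 1\le r<o(a_i)\}$. *)

theory Defs
  imports
    Complex_Main
    "HOL-Algebra.Generated_Groups"
    "HOL-Algebra.Multiplicative_Group"
begin

text \<open>
  The alphabet \<open>{1,\<dots>,d}\<close> is a finite type \<open>'d\<close> with \<open>d = CARD('d)\<close>. The vertices of the rooted
  tree are all finite words \<open>'d list\<close>, the root is \<open>[]\<close>, and the children of \<open>v\<close> are \<open>v @ [x]\<close>.
\<close>

definition tree_adj :: "'d list \<Rightarrow> 'd list \<Rightarrow> bool" where
  "tree_adj v w \<longleftrightarrow> (\<exists>x. w = v @ [x] \<or> v = w @ [x])"

definition tree_automorphism :: "('d list \<Rightarrow> 'd list) \<Rightarrow> bool" where
  "tree_automorphism g \<longleftrightarrow>
     bij g \<and> g [] = [] \<and> (\<forall>v w. tree_adj (g v) (g w) \<longleftrightarrow> tree_adj v w)"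

text \<open>
  Automorphisms act on the right, so \<open>v\<^sup>g\<close> is \<open>g v\<close> and the product \<open>g h\<close>, read from left to right,
  is the function \<open>h \<circ> g\<close>.
\<close>

definition Aut_tree :: "('d list \<Rightarrow> 'd list) monoid" where
  "Aut_tree = \<lparr>carrier = {g. tree_automorphism g}, mult = (\<lambda>g h. h \<circ> g), one = id\<rparr>"

text \<open>
  The section is characterised by \<open>(v w)\<^sup>g = v\<^sup>g w\<^bsup>g|v\<^esup>\<close>; see \<open>tree_automorphism_append\<close> below.
\<close>

definition tree_section :: "('d list \<Rightarrow> 'd list) \<Rightarrow> 'd list \<Rightarrow> 'd list \<Rightarrow> 'd list" where
  "tree_section g v w = drop (length v) (g (v @ w))"

text \<open>
  \<open>spinal_gen \<sigma> i\<close> is \<open>a\<^sub>i\<close>: it acts on the first letter by \<open>\<sigma>\<^sub>i\<close>, and its section at a letter \<open>x\<close> is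
  \<open>a\<^sub>i\<close> if \<open>x = i\<close> and trivial otherwise.
\<close>

primrec spinal_gen :: "('d \<Rightarrow> 'd \<Rightarrow> 'd) \<Rightarrow> 'd \<Rightarrow> 'd list \<Rightarrow> 'd list" where
  "spinal_gen \<sigma> i [] = []"
| "spinal_gen \<sigma> i (x # w) = \<sigma> i x # (if x = i then spinal_gen \<sigma> i w else w)"

definition spinal_hanoi_data :: "('d \<Rightarrow> 'd \<Rightarrow> 'd) \<Rightarrow> bool" where
  "spinal_hanoi_data \<sigma> \<longleftrightarrow> (\<forall>i. bij (\<sigma> i) \<and> \<sigma> i \<noteq> id \<and> \<sigma> i i = i)"

definition spinal_hanoi_group :: "('d \<Rightarrow> 'd \<Rightarrow> 'd) \<Rightarrow> ('d list \<Rightarrow> 'd list) set" where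
  "spinal_hanoi_group \<sigma> = generate Aut_tree (range (spinal_gen \<sigma>))"

definition spinal_order :: "('d \<Rightarrow> 'd \<Rightarrow> 'd) \<Rightarrow> 'd \<Rightarrow> nat" where
  "spinal_order \<sigma> i = group.ord Aut_tree (spinal_gen \<sigma> i)"

text \<open>
  The list \<open>[(i\<^sub>1, r\<^sub>1), \<dots>, (i\<^sub>k, r\<^sub>k)]\<close> stands for the product of the \<open>a\<^bsub>i\<^sub>j\<^esub>\<close> to the power \<open>r\<^sub>j\<close>.
\<close>

definition syllable_word :: "('d \<Rightarrow> 'd \<Rightarrow> 'd) \<Rightarrow> ('d \<times> nat) list \<Rightarrow> bool" where
  "syllable_word \<sigma> ss \<longleftrightarrow>
     (\<forall>j. Suc j < length ss \<longrightarrow> fst (ss ! j) \<noteq> fst (ss ! Suc j)) \<and>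
     (\<forall>(i, r) \<in> set ss. 1 \<le> r \<and> r < spinal_order \<sigma> i)"

definition syllable_eval :: "('d \<Rightarrow> 'd \<Rightarrow> 'd) \<Rightarrow> ('d \<times> nat) list \<Rightarrow> 'd list \<Rightarrow> 'd list" where
  "syllable_eval \<sigma> ss =
     foldr (\<lambda>(i, r) h. (spinal_gen \<sigma> i [^]\<^bsub>Aut_tree\<^esub> r) \<otimes>\<^bsub>Aut_tree\<^esub> h) ss \<one>\<^bsub>Aut_tree\<^esub>"

text \<open>Meaningful for \<open>g\<close> in \<open>spinal_hanoi_group \<sigma>\<close>, where a representation exists.\<close>

definition syl :: "('d \<Rightarrow> 'd \<Rightarrow> 'd) \<Rightarrow> ('d list \<Rightarrow> 'd list) \<Rightarrow> nat" where
  "syl \<sigma> g = (LEAST k. \<exists>ss. length ss = k \<and> syllable_word \<sigma> ss \<and> g = syllable_eval \<sigma> ss)"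

lemma tree_automorphism_snoc:
  assumes "tree_automorphism g"
  shows "\<exists>y. g (v @ [x]) = g v @ [y]"
proof (induction v arbitrary: x rule: rev_induct)
  case Nil
  have "tree_adj [] [x]" by (simp add: tree_adj_def)
  then have "tree_adj (g []) (g [x])" "g [] = []"
    using assms unfolding tree_automorphism_def by blast+
  then show ?case by (auto simp: tree_adj_def)
next
  case (snoc z v)
  have inj: "inj g" using assms by (simp add: tree_automorphism_def bij_def)
  have "tree_adj (g (v @ [z])) (g ((v @ [z]) @ [x]))"
    using assms unfolding tree_automorphism_def tree_adj_def by blast
  moreover have "g (v @ [z]) \<noteq> g ((v @ [z]) @ [x]) @ [y]" for y
  proof
    assume "g (v @ [z]) = g ((v @ [z]) @ [x]) @ [y]"
    moreover obtain y' where "g (v @ [z]) = g v @ [y']" using snoc by blast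
    ultimately have "g v = g ((v @ [z]) @ [x])" by simp
    then show False using injD[OF inj] by fastforce
  qed
  ultimately show ?case unfolding tree_adj_def by blast
qed

lemma tree_automorphism_length:
  assumes "tree_automorphism g"
  shows "length (g v) = length v"
proof (induction v rule: rev_induct)
  case Nil
  then show ?case using assms by (simp add: tree_automorphism_def)
next
  case (snoc x v)
  then show ?case using tree_automorphism_snoc[OF assms, of v x] by auto
qed

lemma tree_automorphism_append:
  assumes "tree_automorphism g"
  shows "g (v @ w) = g v @ tree_section g v w"
proof -
  have "\<exists>u. g (v @ w) = g v @ u"
  proof (induction w rule: rev_induct)
    case (snoc x w)
    then show ?case using tree_automorphism_snoc[OF assms, of "v @ w" x] by auto
  qed simp
  then show ?thesis
    using tree_automorphism_length[OF assms, of v] by (auto simp: tree_section_def)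
qed

lemma group_Aut_tree: "group (Aut_tree :: ('d list \<Rightarrow> 'd list) monoid)"
proof (rule groupI)
  fix g :: "'d list \<Rightarrow> 'd list"
  assume "g \<in> carrier Aut_tree"
  then have g: "bij g" "g [] = []" "\<And>v w. tree_adj (g v) (g w) = tree_adj v w"
    by (auto simp: Aut_tree_def tree_automorphism_def)
  have "tree_automorphism (inv_into UNIV g)"
    unfolding tree_automorphism_def
  proof (intro conjI allI)
    show "bij (inv_into UNIV g)" using g(1) by (rule bij_imp_bij_inv)
    show "inv_into UNIV g [] = []" using g(1,2) by (metis bij_inv_eq_iff)
    show "tree_adj (inv_into UNIV g v) (inv_into UNIV g w) = tree_adj v w" for v w
      using g(3)[of "inv_into UNIV g v" "inv_into UNIV g w"] g(1) by (simp add: bij_is_surj surj_f_inv_f)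
  qed
  moreover have "g \<circ> inv_into UNIV g = id"
    using g(1) by (simp add: bij_is_surj flip: surj_iff)
  ultimately show "\<exists>h\<in>carrier Aut_tree. h \<otimes>\<^bsub>Aut_tree\<^esub> g = \<one>\<^bsub>Aut_tree\<^esub>"
    by (auto simp: Aut_tree_def)
qed (auto simp: Aut_tree_def tree_automorphism_def bij_comp comp_assoc)

lemma spinal_gen_in_Aut_tree:
  assumes "spinal_hanoi_data \<sigma>"
  shows "spinal_gen \<sigma> i \<in> carrier Aut_tree"
proof -
  have b: "bij (\<sigma> i)" and fx: "\<sigma> i i = i"
    using assms by (auto simp: spinal_hanoi_data_def)
  have inj: "spinal_gen \<sigma> i v = spinal_gen \<sigma> i w \<Longrightarrow> v = w" for v w
  proof (induction v arbitrary: w)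
    case Nil
    then show ?case by (cases w) auto
  next
    case (Cons x v)
    then obtain y u where "w = y # u" by (cases w) auto
    with Cons b show ?case by (auto simp: bij_def inj_eq split: if_splits)
  qed
  have surj: "\<exists>v. w = spinal_gen \<sigma> i v" for w
  proof (induction w)
    case Nil
    show ?case by (rule exI[of _ "[]"]) simp
  next
    case (Cons y w)
    obtain v where v: "w = spinal_gen \<sigma> i v" using Cons by blast
    obtain x where x: "y = \<sigma> i x" using b by (metis bij_pointE)
    show ?case by (rule exI[of _ "x # (if x = i then v else w)"]) (simp add: v x)
  qed
  have snoc: "\<exists>y. spinal_gen \<sigma> i (v @ [x]) = spinal_gen \<sigma> i v @ [y]" for v x
    by (induction v) auto
  have len: "length (spinal_gen \<sigma> i v) = length v" for v
    by (induction v) auto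
  have child: "(\<exists>x. w = v @ [x]) \<longleftrightarrow> (\<exists>y. spinal_gen \<sigma> i w = spinal_gen \<sigma> i v @ [y])" for v w
  proof
    assume "\<exists>x. w = v @ [x]"
    then show "\<exists>y. spinal_gen \<sigma> i w = spinal_gen \<sigma> i v @ [y]" using snoc by blast
  next
    assume *: "\<exists>y. spinal_gen \<sigma> i w = spinal_gen \<sigma> i v @ [y]"
    then have "length w = Suc (length v)" using len by (metis length_append_singleton)
    then obtain u x where w: "w = u @ [x]" by (metis length_Suc_conv_rev)
    with * snoc[of u x] have "u = v" using inj by auto
    with w show "\<exists>x. w = v @ [x]" by blast
  qed
  have "bij (spinal_gen \<sigma> i)"
    using inj surj by (auto simp: bij_def inj_def surj_def)
  moreover have "tree_adj (spinal_gen \<sigma> i v) (spinal_gen \<sigma> i w) = tree_adj v w" for v w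
    using child[of w v] child[of v w] unfolding tree_adj_def by blast
  ultimately show ?thesis
    by (simp add: Aut_tree_def tree_automorphism_def)
qed

lemma spinal_gen_section: "tree_section (spinal_gen \<sigma> i) [x] = (if x = i then spinal_gen \<sigma> i else id)"
  by (auto simp: tree_section_def)

end

theory Submission
  imports Defs
begin

text \<open>
  Write \<open>g\<close> as a product of \<open>k\<close> powers \<open>a\<^sub>i\<^sup>r\<close> of generators and follow a letter \<open>x\<close> through the
  product. Since \<open>\<sigma>\<^sub>i\<close> fixes \<open>i\<close>, it never moves another letter onto \<open>i\<close>; so the section of
  \<open>a\<^sub>i\<^sup>r\<close> at \<open>i\<close> is \<open>a\<^sub>i\<^sup>r\<close>, while its other first-level sections are trivial. Hence \<open>g|\<^sub>x\<close> is
  the product of those syllables whose index is the letter reached from \<open>x\<close> just before they act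
  (\<open>section_word\<close>).

  Each syllable acts on the first level as a permutation, so its index is reached from exactly one
  starting letter: the syllables of \<open>g\<close> are distributed among its \<open>d\<close> sections, and their number is
  preserved in total (\<open>sum_length_section_word\<close>). After a syllable with index \<open>i\<close> has contributed,
  the current letter is still \<open>i\<close>, and in a reduced word the next index differs from \<open>i\<close>; so two
  consecutive syllables never contribute to the same section, and each section receives at most
  half of them, rounded up (\<open>length_section_word\<close>).

  The selected subword need not be reduced. Merging neighbours with the same index, reducing
  exponents modulo the order of the generator and dropping trivial syllables never
  increases the number of syllables (\<open>syl_syllable_eval_le\<close>), which turns both counts into the
  claimed bounds. The same reduction shows that every element of the group has a reduced word, because
  the generators have finite order.
\<close>

section \<open>Powers of the generators\<close>

interpretation Aut_tree: group "Aut_tree :: ('d list \<Rightarrow> 'd list) monoid"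
  by (rule group_Aut_tree)

lemma mult_Aut_tree_apply: "(g \<otimes>\<^bsub>Aut_tree\<^esub> h) v = h (g v)"
  by (simp add: Aut_tree_def)

lemma one_Aut_tree_apply: "\<one>\<^bsub>Aut_tree\<^esub> v = v"
  by (simp add: Aut_tree_def)

lemma spinal_gen_pow_Nil: "(spinal_gen \<sigma> i [^]\<^bsub>Aut_tree\<^esub> (r::nat)) [] = []"
  by (induction r) (simp_all add: mult_Aut_tree_apply one_Aut_tree_apply)

lemma funpow_fixed_point: "f x = x \<Longrightarrow> (f ^^ n) x = x"
  by (induction n) simp_all

lemma bij_finite_funpow_eq_id:
  fixes f :: "'d::finite \<Rightarrow> 'd"
  assumes "bij f"
  obtains n where "n > 0" "f ^^ n = id"
proof -
  have "\<not> inj (\<lambda>n. f ^^ n)"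
    using finite_imageD[of "\<lambda>n. f ^^ n" UNIV] by auto
  then obtain m n where "m < n" "f ^^ m = f ^^ n"
    by (metis injI linorder_neqE_nat)
  then have "(f ^^ m) ((f ^^ (n - m)) x) = (f ^^ m) x" for x
    by (metis comp_apply funpow_add le_add_diff_inverse less_imp_le)
  then have "(f ^^ (n - m)) x = x" for x
    using inj_fn[OF bij_is_inj[OF assms], of m] by (metis injD)
  with \<open>m < n\<close> show thesis
    by (intro that[of "n - m"]) (auto simp: fun_eq_iff)
qed

text \<open>
  The orbit of a letter \<open>x \<noteq> i\<close> under \<open>\<sigma>\<^sub>i\<close> never meets the fixed point \<open>i\<close>, so no factor
  of \<open>a\<^sub>i\<^sup>r\<close> ever contributes to its section at \<open>x\<close>.
\<close>

lemma spinal_gen_pow_Cons: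
  assumes "spinal_hanoi_data \<sigma>"
  shows "(spinal_gen \<sigma> i [^]\<^bsub>Aut_tree\<^esub> (r::nat)) (x # w) =
    (\<sigma> i ^^ r) x # (if x = i then (spinal_gen \<sigma> i [^]\<^bsub>Aut_tree\<^esub> r) w else w)"
proof -
  have "inj (\<sigma> i)" and "\<sigma> i i = i"
    using assms by (auto simp: spinal_hanoi_data_def bij_def)
  moreover from this have "inj (\<sigma> i ^^ r)" "(\<sigma> i ^^ r) i = i" for r
    by (simp_all add: funpow_fixed_point)
  ultimately have eq_iff: "(\<sigma> i ^^ r) x = i \<longleftrightarrow> x = i" for r x
    by (metis injD)
  show ?thesis
    by (induction r) (auto simp: mult_Aut_tree_apply one_Aut_tree_apply eq_iff)
qed

text \<open>
  If \<open>\<sigma>\<^sub>i\<^sup>n = 1\<close>, then \<open>a\<^sub>i\<^sup>n\<close> fixes the first level and has itself as its only possibly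
  nontrivial section there, so it is trivial by induction on the length of words. Finite order is
  what lets inverses of generators be written as syllables.
\<close>

lemma spinal_order_pos:
  fixes \<sigma> :: "'d::finite \<Rightarrow> 'd \<Rightarrow> 'd"
  assumes "spinal_hanoi_data \<sigma>"
  shows "0 < spinal_order \<sigma> i"
proof -
  have "bij (\<sigma> i)" using assms by (simp add: spinal_hanoi_data_def)
  then obtain n where "n > 0" and n: "\<sigma> i ^^ n = id"
    using bij_finite_funpow_eq_id by blast
  have "(spinal_gen \<sigma> i [^]\<^bsub>Aut_tree\<^esub> n) w = w" for w
    by (induction w) (simp_all add: spinal_gen_pow_Nil spinal_gen_pow_Cons[OF assms] n)
  then have "spinal_gen \<sigma> i [^]\<^bsub>Aut_tree\<^esub> n = \<one>\<^bsub>Aut_tree\<^esub>"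
    by (simp add: fun_eq_iff one_Aut_tree_apply)
  then have "spinal_order \<sigma> i dvd n"
    using Aut_tree.pow_eq_id[OF spinal_gen_in_Aut_tree[OF assms]] by (simp add: spinal_order_def)
  with \<open>n > 0\<close> show ?thesis by (auto intro: Nat.gr0I)
qed

lemma spinal_gen_pow_mod_order:
  assumes "spinal_hanoi_data \<sigma>"
  shows "spinal_gen \<sigma> i [^]\<^bsub>Aut_tree\<^esub> (r mod spinal_order \<sigma> i) = spinal_gen \<sigma> i [^]\<^bsub>Aut_tree\<^esub> r"
proof -
  define a n where "a = spinal_gen \<sigma> i" and "n = spinal_order \<sigma> i"
  have a: "a \<in> carrier Aut_tree" and "a [^]\<^bsub>Aut_tree\<^esub> n = \<one>\<^bsub>Aut_tree\<^esub>"
    using spinal_gen_in_Aut_tree[OF assms, of i]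
    by (simp_all add: a_def n_def spinal_order_def Aut_tree.pow_ord_eq_1)
  then have "a [^]\<^bsub>Aut_tree\<^esub> (n * q) \<otimes>\<^bsub>Aut_tree\<^esub> a [^]\<^bsub>Aut_tree\<^esub> s = a [^]\<^bsub>Aut_tree\<^esub> s" for q s :: nat
    by (simp flip: Aut_tree.nat_pow_pow)
  then have "a [^]\<^bsub>Aut_tree\<^esub> (r mod n) = a [^]\<^bsub>Aut_tree\<^esub> r"
    by (metis a Aut_tree.nat_pow_mult mult_div_mod_eq)
  then show ?thesis by (simp add: a_def n_def)
qed

section \<open>Reduction of syllable words\<close>

lemma syllable_eval_Nil [simp]: "syllable_eval \<sigma> [] = \<one>\<^bsub>Aut_tree\<^esub>"
  by (simp add: syllable_eval_def)

lemma syllable_eval_Cons [simp]: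
  "syllable_eval \<sigma> ((i, r) # ss) =
    (spinal_gen \<sigma> i [^]\<^bsub>Aut_tree\<^esub> r) \<otimes>\<^bsub>Aut_tree\<^esub> syllable_eval \<sigma> ss"
  by (simp add: syllable_eval_def)

lemma syllable_eval_closed:
  assumes "spinal_hanoi_data \<sigma>"
  shows "syllable_eval \<sigma> ss \<in> carrier Aut_tree"
  by (induction ss) (auto simp: spinal_gen_in_Aut_tree[OF assms])

lemma syllable_eval_append:
  assumes "spinal_hanoi_data \<sigma>"
  shows "syllable_eval \<sigma> (ss @ ts) = syllable_eval \<sigma> ss \<otimes>\<^bsub>Aut_tree\<^esub> syllable_eval \<sigma> ts"
  by (induction ss)
    (auto simp: Aut_tree.m_assoc spinal_gen_in_Aut_tree[OF assms] syllable_eval_closed[OF assms])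

lemma syllable_word_iff_distinct_adj:
  "syllable_word \<sigma> ss \<longleftrightarrow>
    distinct_adj (map fst ss) \<and> (\<forall>(i, r)\<in>set ss. 1 \<le> r \<and> r < spinal_order \<sigma> i)"
  by (auto simp: syllable_word_def distinct_adj_conv_nth Suc_lessD)

text \<open>
  Prepending a syllable to a reduced word costs at most one merge: what is left of a reduced word
  after its first syllable does not start with the same index, so even if the merged syllable
  cancels, no further reduction is triggered.
\<close>

lemma exists_syllable_word_same_eval:
  fixes \<sigma> :: "'d::finite \<Rightarrow> 'd \<Rightarrow> 'd"
  assumes "spinal_hanoi_data \<sigma>"
  shows "\<exists>ts. syllable_word \<sigma> ts \<and> length ts \<le> length ss \<and> syllable_eval \<sigma> ts = syllable_eval \<sigma> ss"
proof (induction ss)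
  case Nil
  show ?case by (rule exI[of _ "[]"]) (simp add: syllable_word_def)
next
  case (Cons s ss)
  obtain i r where s: "s = (i, r)" by fastforce
  obtain ts where ts: "syllable_word \<sigma> ts" "length ts \<le> length ss"
    "syllable_eval \<sigma> ts = syllable_eval \<sigma> ss"
    using Cons.IH by blast
  (* Split off the possible leading syllable with index i, so that the new one merges with it;
     if there is none, q = 0 makes the split vacuous. *)
  obtain q us where us: "syllable_word \<sigma> us" "length us \<le> length ss"
    "us = [] \<or> fst (hd us) \<noteq> i" "syllable_eval \<sigma> ts = syllable_eval \<sigma> ((i, q) # us)"
  proof (cases "ts \<noteq> [] \<and> fst (hd ts) = i")
    case True
    then obtain q us where *: "ts = (i, q) # us" by (cases ts) auto
    show thesis
      by (rule that[of us q]) (use ts * in \<open>auto simp: syllable_word_iff_distinct_adj distinct_adj_Cons hd_map\<close>)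
  next
    case False
    show thesis
      by (rule that[of ts 0]) (use ts False syllable_eval_closed[OF assms, of ts] in auto)
  qed
  define p where "p = (r + q) mod spinal_order \<sigma> i"
  have "syllable_eval \<sigma> (s # ss) =
      (spinal_gen \<sigma> i [^]\<^bsub>Aut_tree\<^esub> (r + q)) \<otimes>\<^bsub>Aut_tree\<^esub> syllable_eval \<sigma> us"
    using us(4) ts(3)
    by (simp add: s Aut_tree.m_assoc flip: Aut_tree.nat_pow_mult[OF spinal_gen_in_Aut_tree[OF assms]])
      (simp add: Aut_tree.m_assoc spinal_gen_in_Aut_tree[OF assms] syllable_eval_closed[OF assms])
  then have eval: "syllable_eval \<sigma> (s # ss) = syllable_eval \<sigma> ((i, p) # us)"
    by (simp add: p_def spinal_gen_pow_mod_order[OF assms])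
  show ?case
  proof (cases "p = 0")
    case True
    show ?thesis
      by (rule exI[of _ us])
        (use us eval True syllable_eval_closed[OF assms, of us] in auto)
  next
    case False
    have "p < spinal_order \<sigma> i" by (simp add: p_def spinal_order_pos[OF assms])
    then show ?thesis
      by (intro exI[of _ "(i, p) # us"])
        (use us eval False in \<open>auto simp: syllable_word_iff_distinct_adj distinct_adj_Cons hd_map\<close>)
  qed
qed

lemma syl_syllable_eval_le:
  fixes \<sigma> :: "'d::finite \<Rightarrow> 'd \<Rightarrow> 'd"
  assumes "spinal_hanoi_data \<sigma>"
  shows "syl \<sigma> (syllable_eval \<sigma> ss) \<le> length ss"
proof -
  obtain ts where "syllable_word \<sigma> ts" "length ts \<le> length ss"
    "syllable_eval \<sigma> ts = syllable_eval \<sigma> ss"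
    using exists_syllable_word_same_eval[OF assms] by blast
  moreover from this have "syl \<sigma> (syllable_eval \<sigma> ss) \<le> length ts"
    unfolding syl_def by (intro Least_le) metis
  ultimately show ?thesis by simp
qed

lemma spinal_hanoi_group_syllable_eval:
  fixes \<sigma> :: "'d::finite \<Rightarrow> 'd \<Rightarrow> 'd"
  assumes "spinal_hanoi_data \<sigma>" and "g \<in> spinal_hanoi_group \<sigma>"
  shows "\<exists>ss. g = syllable_eval \<sigma> ss"
  using assms(2) unfolding spinal_hanoi_group_def
proof (induction rule: generate.induct)
  case one
  show ?case by (rule exI[of _ "[]"]) simp
next
  case (incl h)
  then obtain i where "h = spinal_gen \<sigma> i" by blast
  then show ?case
    by (intro exI[of _ "[(i, 1)]"]) (simp add: spinal_gen_in_Aut_tree[OF assms(1)])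
next
  case (inv h)
  then obtain i where h: "h = spinal_gen \<sigma> i" by blast
  let ?n = "spinal_order \<sigma> i"
  have "h \<in> carrier Aut_tree" by (simp add: h spinal_gen_in_Aut_tree[OF assms(1)])
  moreover have "h [^]\<^bsub>Aut_tree\<^esub> (?n - 1) \<otimes>\<^bsub>Aut_tree\<^esub> h = h [^]\<^bsub>Aut_tree\<^esub> ?n"
    using spinal_order_pos[OF assms(1), of i]
    by (metis Aut_tree.nat_pow_Suc Suc_diff_1)
  moreover have "h [^]\<^bsub>Aut_tree\<^esub> ?n = \<one>\<^bsub>Aut_tree\<^esub>"
    using \<open>h \<in> carrier Aut_tree\<close> by (simp add: spinal_order_def h Aut_tree.pow_ord_eq_1)
  ultimately have "inv\<^bsub>Aut_tree\<^esub> h = h [^]\<^bsub>Aut_tree\<^esub> (?n - 1)"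
    by (metis Aut_tree.inv_equality Aut_tree.nat_pow_closed)
  then show ?case
    by (intro exI[of _ "[(i, ?n - 1)]"]) (simp add: h spinal_gen_in_Aut_tree[OF assms(1)])
next
  case (eng h1 h2)
  then show ?case by (metis syllable_eval_append[OF assms(1)])
qed

lemma obtain_minimal_syllable_word:
  fixes \<sigma> :: "'d::finite \<Rightarrow> 'd \<Rightarrow> 'd"
  assumes "spinal_hanoi_data \<sigma>" and "g \<in> spinal_hanoi_group \<sigma>"
  obtains ss where "length ss = syl \<sigma> g" "syllable_word \<sigma> ss" "g = syllable_eval \<sigma> ss"
proof -
  have "\<exists>k ss. length ss = k \<and> syllable_word \<sigma> ss \<and> g = syllable_eval \<sigma> ss"
    using spinal_hanoi_group_syllable_eval[OF assms] exists_syllable_word_same_eval[OF assms(1)]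
    by metis
  then have "\<exists>ss. length ss = syl \<sigma> g \<and> syllable_word \<sigma> ss \<and> g = syllable_eval \<sigma> ss"
    unfolding syl_def by (rule LeastI_ex)
  then show thesis using that by blast
qed

section \<open>Sections of a product of syllables\<close>

text \<open>
  The subword of those syllables \<open>(i, r)\<close> that meet the letter \<open>i\<close> along the path of \<open>x\<close>; by
  \<open>tree_section_syllable_eval\<close> it represents the section at \<open>x\<close>.
\<close>

primrec section_word :: "('d \<Rightarrow> 'd \<Rightarrow> 'd) \<Rightarrow> 'd \<Rightarrow> ('d \<times> nat) list \<Rightarrow> ('d \<times> nat) list" where
  "section_word \<sigma> x [] = []"
| "section_word \<sigma> x (s # ss) =
    (if x = fst s then [s] else []) @ section_word \<sigma> ((\<sigma> (fst s) ^^ snd s) x) ss"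

lemma tree_section_syllable_eval:
  assumes "spinal_hanoi_data \<sigma>"
  shows "tree_section (syllable_eval \<sigma> ss) [x] = syllable_eval \<sigma> (section_word \<sigma> x ss)"
proof -
  have "\<exists>y. syllable_eval \<sigma> ss (x # w) = y # syllable_eval \<sigma> (section_word \<sigma> x ss) w" for w
  proof (induction ss arbitrary: x w)
    case (Cons s ss)
    obtain i r where "s = (i, r)" by fastforce
    then show ?case
      using Cons.IH by (simp add: mult_Aut_tree_apply spinal_gen_pow_Cons[OF assms])
  qed (simp add: one_Aut_tree_apply)
  then have "drop 1 (syllable_eval \<sigma> ss (x # w)) = syllable_eval \<sigma> (section_word \<sigma> x ss) w" for w
    by (metis One_nat_def drop0 drop_Suc_Cons)
  then show ?thesis by (simp add: tree_section_def fun_eq_iff)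
qed

text \<open>
  The first syllable contributes to the section at its own index only, and the permutation by which
  it acts merely reindexes the sum over the starting letters of the remaining word.
\<close>

lemma sum_length_section_word:
  fixes \<sigma> :: "'d::finite \<Rightarrow> 'd \<Rightarrow> 'd"
  assumes "\<And>i. bij (\<sigma> i)"
  shows "(\<Sum>x\<in>UNIV. length (section_word \<sigma> x ss)) = length ss"
proof (induction ss)
  case (Cons s ss)
  obtain i r where s: "s = (i, r)" by fastforce
  have "bij (\<sigma> i ^^ r)" using assms by (simp add: bij_fn)
  then have "(\<Sum>x\<in>UNIV. length (section_word \<sigma> ((\<sigma> i ^^ r) x) ss)) = length ss"
    using sum.reindex_bij_betw[of "\<sigma> i ^^ r" UNIV UNIV "\<lambda>x. length (section_word \<sigma> x ss)"] Cons.IH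
    by simp
  moreover have "length (section_word \<sigma> x (s # ss)) =
      (if x = i then 1 else 0) + length (section_word \<sigma> ((\<sigma> i ^^ r) x) ss)" for x
    by (simp add: s)
  ultimately show ?case by (simp add: sum.distrib)
qed simp

text \<open>
  The second bound, for words that do not start with the index \<open>x\<close>, is what the
  induction needs: it applies to the remaining word once a syllable has contributed, because the
  path then stays at the index of that syllable, which the next syllable cannot share.
\<close>

lemma length_section_word:
  assumes "\<And>i. \<sigma> i i = i" and "distinct_adj (map fst ss)"
  shows "length (section_word \<sigma> x ss) \<le> (length ss + 1) div 2"
    and "ss = [] \<or> fst (hd ss) \<noteq> x \<Longrightarrow> length (section_word \<sigma> x ss) \<le> length ss div 2"
  using assms(2)
proof (induction ss arbitrary: x)
  case (Cons s ss)
  have fixed: "(\<sigma> (fst s) ^^ snd s) (fst s) = fst s"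
    by (rule funpow_fixed_point[OF assms(1)])
  have moved: "length (section_word \<sigma> x (s # ss)) \<le> length (s # ss) div 2"
    if "x \<noteq> fst s" "distinct_adj (map fst (s # ss))" for x
    using Cons.IH(1) that by (simp add: distinct_adj_ConsD)
  {
    case 1
    then have "distinct_adj (map fst ss)" "ss = [] \<or> fst (hd ss) \<noteq> fst s"
      by (auto simp: distinct_adj_Cons hd_map)
    then show ?case
      using Cons.IH(2)[of "fst s"] moved[OF _ 1] fixed by (cases "x = fst s") fastforce+
  next
    case 2
    then show ?case using moved by auto
  }
qed simp_all

section \<open>Syllable lengths of sections\<close>

theorem proposition3p6:
  fixes \<sigma> :: "'d::finite \<Rightarrow> 'd \<Rightarrow> 'd"
  assumes "spinal_hanoi_data \<sigma>"
  shows "(\<forall>g\<in>spinal_hanoi_group \<sigma>. \<forall>i.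
            int (syl \<sigma> (tree_section g [i])) \<le> \<lceil>real (syl \<sigma> g) / 2\<rceil>)
       \<and> (\<forall>g\<in>spinal_hanoi_group \<sigma>.
            (\<Sum>i\<in>UNIV. syl \<sigma> (tree_section g [i])) \<le> syl \<sigma> g)"
proof (intro conjI ballI allI)
  have fixes_index: "\<sigma> i i = i" and bij: "bij (\<sigma> i)" for i
    using assms by (simp_all add: spinal_hanoi_data_def)
  fix g assume "g \<in> spinal_hanoi_group \<sigma>"
  then obtain ss where ss: "length ss = syl \<sigma> g" "syllable_word \<sigma> ss" "g = syllable_eval \<sigma> ss"
    using obtain_minimal_syllable_word[OF assms] by blast
  have le: "syl \<sigma> (tree_section g [x]) \<le> length (section_word \<sigma> x ss)" for x
    unfolding ss(3) tree_section_syllable_eval[OF assms] by (rule syl_syllable_eval_le[OF assms])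
  show "int (syl \<sigma> (tree_section g [i])) \<le> \<lceil>real (syl \<sigma> g) / 2\<rceil>" for i
  proof -
    have "syl \<sigma> (tree_section g [i]) \<le> (syl \<sigma> g + 1) div 2"
      using le[of i] length_section_word(1)[of \<sigma> ss i] fixes_index ss(1,2)
      by (simp add: syllable_word_iff_distinct_adj)
    then show ?thesis by linarith
  qed
  show "(\<Sum>i\<in>UNIV. syl \<sigma> (tree_section g [i])) \<le> syl \<sigma> g"
    using sum_mono[of UNIV "\<lambda>i. syl \<sigma> (tree_section g [i])", OF le] sum_length_section_word[of \<sigma> ss] bij ss(1) by simp
qed

end
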